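(* Let $X$, $Y$ be vector spaces over a field $\mathbb{K}$ and let $\mathcal{L}:X\to Y$ be linear with $\dim\ker\mathcal{L}=k$, where $k>0$ is a (finite) integer. Let further $b\in Y$, $d\in\mathbb{K}$, and let $f:X\to\mathbb{K}$ be a linear functional. Define the operator $\widetilde{\mathcal{L}}:X\times\mathbb{K}\to Y\times\mathbb{K}$ by $$\widetilde{\mathcal{L}}\begin{pmatrix}x\\ \xi\end{pmatrix}=\begin{pmatrix}\mathcal{L}x+b\,\xi\\ f(x)+d\,\xi\end{pmatrix}\qquad\text{for all }(x,\xi)\in X\times\mathbb{K}.$$ Then $\dim\ker\widetilde{\mathcal{L}}<k$ if and only if $b$ does not belong to the range of $\mathcal{L}$ and there exists $v\in\ker\mathcal{L}$ with $f(v)\neq 0$. *)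

theory Defs
  imports "HOL-Analysis.Product_Vector" "HOL-Library.Extended_Nat"
begin

text \<open>
  The library's \<open>dim\<close> is a natural number and is \<open>0\<close> on infinite-dimensional subspaces, so that
  \<open>dim V < k\<close> would hold for them. Here such subspaces have dimension \<open>\<infinity>\<close>.
\<close>

definition (in vector_space) edim :: "'b set \<Rightarrow> enat" where
  "edim V = (if \<exists>B. finite B \<and> V \<subseteq> span B then enat (dim V) else \<infinity>)"

lemma (in vector_space) edim_eq_enat_iff:
  "edim V = enat n \<longleftrightarrow> (\<exists>B. finite B \<and> independent B \<and> span B = span V \<and> card B = n)"
proof
  assume "edim V = enat n"
  then obtain C where C: "finite C" "V \<subseteq> span C" and n: "dim V = n"
    by (auto simp: edim_def split: if_splits)
  obtain B where B: "B \<subseteq> V" "independent B" "V \<subseteq> span B" "card B = dim V"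
    by (rule basis_exists)
  have "finite B"
    using independent_span_bound[OF C(1) B(2)] B(1) C(2) by auto
  moreover have "span B = span V"
    using B(1,3) span_mono[of B V] span_minimal[of V "span B"] by auto
  ultimately show "\<exists>B. finite B \<and> independent B \<and> span B = span V \<and> card B = n"
    using B n by blast
next
  assume "\<exists>B. finite B \<and> independent B \<and> span B = span V \<and> card B = n"
  then obtain B where B: "finite B" "independent B" "span B = span V" "card B = n"
    by blast
  then have "V \<subseteq> span B"
    using span_superset by simp
  with B show "edim V = enat n"
    unfolding edim_def using dim_eq_card[OF B(3,2)] by auto
qed

definition kernel :: "('a \<Rightarrow> 'b::zero) \<Rightarrow> 'a set" where
  "kernel T = {x. T x = 0}"

definition bordered ::
  "('k::field \<Rightarrow> 'y::ab_group_add \<Rightarrow> 'y) \<Rightarrow> ('x \<Rightarrow> 'y) \<Rightarrow> 'y \<Rightarrow> ('x \<Rightarrow> 'k) \<Rightarrow> 'k \<Rightarrow> 'x \<times> 'k \<Rightarrow> 'y \<times> 'k"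
  where "bordered sY L b f d = (\<lambda>(x, \<xi>). (L x + sY \<xi> b, f x + d * \<xi>))"

text \<open>The field \<open>'k\<close> is a vector space over itself with scalar multiplication \<open>(*)\<close>.\<close>

lemma linear_bordered:
  assumes "Vector_Spaces.linear sX sY L" "Vector_Spaces.linear sX (*) f"
  shows "Vector_Spaces.linear (module_prod.scale sX (*)) (module_prod.scale sY (*)) (bordered sY L b f d)"
proof -
  interpret L: Vector_Spaces.linear sX sY L by fact
  interpret f: Vector_Spaces.linear sX "(*)" f by fact
  interpret X: vector_space_prod sX "(*)" ..
  interpret Y: vector_space_prod sY "(*)" ..
  show ?thesis
    by unfold_locales
      (simp_all add: bordered_def X.scale_def Y.scale_def L.add L.scale f.add f.scale
        split_beta L.vs2.scale_right_distrib L.vs2.scale_left_distrib distrib_left mult.left_commute)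
qed

end

theory Submission
  imports Defs
begin

text \<open>
  If \<open>b\<close> is not in the range of \<open>L\<close>, then the first projection embeds the kernel of the bordered
  operator into \<open>ker L \<inter> ker f\<close>, a proper subspace of \<open>ker L\<close> if \<open>f\<close> does not vanish on \<open>ker L\<close>.
  In the remaining cases, a suitable \<open>p\<close> makes \<open>w \<mapsto> (w + f(w) p, f(w))\<close> an embedding of \<open>ker L\<close>
  into the kernel of the bordered operator: \<open>p = 0\<close> if \<open>f\<close> vanishes on \<open>ker L\<close>, and
  \<open>p = u - v/f(v)\<close> if \<open>v \<in> ker L\<close>, \<open>f(v) \<noteq> 0\<close> and \<open>(u, 1)\<close> is in the kernel of the bordered operator.
\<close>

context vector_space
begin

lemma edim_basis:
  assumes "finite B" "independent B" "B \<subseteq> V" "V \<subseteq> span B"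
  shows "edim V = enat (card B)"
  using assms basis_card_eq_dim[of B V] by (auto simp: edim_def)

text \<open>Steinitz exchange against a finite basis of the span of \<open>V\<close>. Finiteness is
  part of the conclusion because \<open>card\<close> is 0 on infinite sets.\<close>

lemma card_independent_le_edim:
  assumes "independent B" "B \<subseteq> V" "edim V = enat n"
  shows "finite B \<and> card B \<le> n"
proof -
  obtain C where C: "finite C" "span C = span V" "card C = n"
    using assms(3) unfolding edim_eq_enat_iff by blast
  have "B \<subseteq> span C"
    using assms(2) C(2) span_superset by blast
  then show ?thesis
    using independent_span_bound[OF C(1) assms(1)] C(3) by blast
qed

text \<open>A basis of \<open>U\<close> stays independent when a vector of \<open>V\<close> outside
  \<open>U\<close> is adjoined, so it has fewer than \<open>n\<close> elements.\<close>

lemma edim_psubset: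
  assumes "subspace U" "U \<subset> V" "edim V = enat n"
  shows "edim U < enat n"
proof -
  obtain B where B: "B \<subseteq> U" "independent B" "U \<subseteq> span B"
    by (rule basis_exists)
  obtain v where v: "v \<in> V" "v \<notin> U"
    using assms(2) by blast
  have "span B \<subseteq> U"
    using B(1) assms(1) by (rule span_minimal)
  with v have nspan: "v \<notin> span B"
    by blast
  then have "v \<notin> B"
    using span_base[of v B] by blast
  moreover have "independent (insert v B)"
    using B(2) nspan by (simp add: independent_insert)
  then have "finite (insert v B) \<and> card (insert v B) \<le> n"
    using assms B(1) v(1) by (intro card_independent_le_edim) auto
  ultimately show ?thesis
    using edim_basis[OF _ B(2,1,3)] by auto
qed

end

text \<open>A basis of \<open>V\<close> is mapped injectively onto an independent subset of
  \<open>W\<close>, so a finite dimension of \<open>W\<close> bounds its size.\<close>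

lemma edim_le_inj_on:
  assumes "Vector_Spaces.linear s1 s2 T" "module.subspace s1 V" "inj_on T V" "T ` V \<subseteq> W"
  shows "vector_space.edim s1 V \<le> vector_space.edim s2 W"
proof -
  interpret T: Vector_Spaces.linear s1 s2 T by fact
  show ?thesis
  proof (cases "T.vs2.edim W")
    case (enat n)
    obtain B where B: "B \<subseteq> V" "T.vs1.independent B" "V \<subseteq> T.vs1.span B"
      by (rule T.vs1.basis_exists)
    \<comment> \<open>Injectivity on the whole span of \<open>B\<close>, not only on
      \<open>B\<close>, keeps the image of \<open>B\<close> independent.\<close>
    have "T.vs1.span B = V"
      using B assms(2) T.vs1.span_minimal[of B V] by blast
    then have "T.vs2.independent (T ` B)"
      using T.independent_inj_on_image[OF B(2)] assms(3) by simp
    then have TB: "finite (T ` B) \<and> card (T ` B) \<le> n"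
      using enat B(1) assms(4) by (intro T.vs2.card_independent_le_edim) auto
    have inj: "inj_on T B"
      using assms(3) B(1) by (rule inj_on_subset)
    then have "finite B" "card B \<le> n"
      using TB by (simp_all add: finite_image_iff card_image)
    then show ?thesis
      using T.vs1.edim_basis B enat by simp
  qed simp
qed

theorem lemmaA1:
  fixes sX :: "'k::field \<Rightarrow> 'x::ab_group_add \<Rightarrow> 'x"
    and sY :: "'k \<Rightarrow> 'y::ab_group_add \<Rightarrow> 'y"
    and L :: "'x \<Rightarrow> 'y" and f :: "'x \<Rightarrow> 'k"
    and b :: 'y and d :: 'k and k :: nat
  assumes "vector_space sX" and "vector_space sY"
    and "Vector_Spaces.linear sX sY L"
    and "vector_space.edim sX (kernel L) = enat k" and "k > 0"
    and "Vector_Spaces.linear sX (*) f"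
  shows "vector_space.edim (module_prod.scale sX (*)) (kernel (bordered sY L b f d)) < enat k
    \<longleftrightarrow> b \<notin> range L \<and> (\<exists>v \<in> kernel L. f v \<noteq> 0)"
proof -
  interpret L: Vector_Spaces.linear sX sY L by fact
  interpret f: Vector_Spaces.linear sX "(*)" f by fact
  interpret X: vector_space_prod sX "(*)" ..
  interpret Y: vector_space_prod sY "(*)" ..
  interpret B: Vector_Spaces.linear X.scale Y.scale "bordered sY L b f d"
    using assms(3,6) by (rule linear_bordered)
  let ?K = "kernel (bordered sY L b f d)"
  have K: "(x, \<xi>) \<in> ?K \<longleftrightarrow> L x + sY \<xi> b = 0 \<and> f x + d * \<xi> = 0" for x \<xi>
    by (simp add: kernel_def bordered_def zero_prod_def)
  have sub: "L.vs1.subspace (kernel L)" "L.vs1.subspace (kernel f)" "X.p.subspace ?K"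
    unfolding kernel_def by (rule L.subspace_kernel f.subspace_kernel B.subspace_kernel)+
  have embed: "enat k \<le> X.p.edim ?K"
    if "\<And>w. w \<in> kernel L \<Longrightarrow> (w + sX (f w) p, f w) \<in> ?K" for p
  proof -
    let ?T = "\<lambda>w. (w + sX (f w) p, f w)"
    have "Vector_Spaces.linear sX X.scale ?T"
      by unfold_locales
        (simp_all add: X.scale_def f.add f.scale L.vs1.scale_right_distrib L.vs1.scale_left_distrib)
    \<comment> \<open>Equal second components give equal \<open>f w\<close>, so the shifts by
      \<open>sX (f w) p\<close> cancel in the first.\<close>
    moreover have "inj_on ?T (kernel L)"
      by (auto simp: inj_on_def)
    moreover have "?T ` kernel L \<subseteq> ?K"
      using that by blast
    ultimately show ?thesis
      unfolding assms(4)[symmetric] by (rule edim_le_inj_on[OF _ sub(1)])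
  qed
  show ?thesis
  proof
    assume less: "X.p.edim ?K < enat k"
    have "\<exists>v \<in> kernel L. f v \<noteq> 0"
    proof (rule ccontr)
      assume "\<not> ?thesis"
      then have "enat k \<le> X.p.edim ?K"
        by (intro embed[of 0]) (simp add: K, simp add: kernel_def)
      with less show False by simp
    qed
    then obtain v where v: "L v = 0" "f v \<noteq> 0"
      by (auto simp: kernel_def)
    moreover have "b \<notin> range L"
    proof
      assume "b \<in> range L"
      then obtain x where x: "b = L x" by blast
      \<comment> \<open>The vector \<open>- x\<close> solves \<open>L u = - b\<close>; adding a
        multiple of \<open>v\<close> preserves this and adjusts \<open>f u\<close> to
        \<open>- d\<close>, so that \<open>(u, 1)\<close> lies in \<open>?K\<close>.\<close>
      define u where "u = sX ((f x - d) / f v) v - x"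
      have u: "L u = - b" "f u = - d"
        using v x by (simp_all add: u_def L.diff L.scale f.diff f.scale)
      have "enat k \<le> X.p.edim ?K"
      proof (rule embed)
        fix w assume "w \<in> kernel L"
        then have "L w = 0"
          by (simp add: kernel_def)
        \<comment> \<open>The pair is the sum of \<open>(w - sX (f w / f v) v, 0)\<close>, whose
          first entry is killed by both \<open>L\<close> and \<open>f\<close>, and of
          \<open>f w\<close> times \<open>(u, 1)\<close>.\<close>
        then show "(w + sX (f w) (u - sX (1 / f v) v), f w) \<in> ?K"
          using u v by (simp add: K L.add L.diff L.scale f.add f.diff f.scale algebra_simps)
      qed
      with less show False by simp
    qed
    ultimately show "b \<notin> range L \<and> (\<exists>v \<in> kernel L. f v \<noteq> 0)"
      by (auto simp: kernel_def)
  next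
    assume *: "b \<notin> range L \<and> (\<exists>v \<in> kernel L. f v \<noteq> 0)"
    \<comment> \<open>A nonzero \<xi> would exhibit \<open>b\<close> as the image under
      \<open>L\<close> of \<open>x\<close> divided by \<open>- \<xi>\<close>.\<close>
    have zero: "\<xi> = 0" if "(x, \<xi>) \<in> ?K" for x \<xi>
    proof (rule ccontr)
      assume "\<xi> \<noteq> 0"
      have "sY \<xi> b = - L x"
        using that by (simp add: K eq_neg_iff_add_eq_0 add.commute)
      then have "L (sX (- inverse \<xi>) x) = sY (inverse \<xi>) (sY \<xi> b)"
        by (simp add: L.neg L.scale)
      also have "\<dots> = b"
        using \<open>\<xi> \<noteq> 0\<close> by simp
      finally show False
        using * by blast
    qed
    have "X.p.edim ?K \<le> L.vs1.edim (kernel L \<inter> kernel f)"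
    proof (rule edim_le_inj_on[OF _ sub(3)])
      show "Vector_Spaces.linear X.scale sX fst"
        by unfold_locales (simp_all add: X.scale_def)
      show "inj_on fst ?K"
        by (auto simp: inj_on_def dest: zero)
      show "fst ` ?K \<subseteq> kernel L \<inter> kernel f"
      proof (rule image_subsetI)
        fix z assume "z \<in> ?K"
        then obtain x where "(x, 0) \<in> ?K" "z = (x, 0)"
          using zero by (metis surj_pair)
        then show "fst z \<in> kernel L \<inter> kernel f"
          unfolding K by (simp add: kernel_def)
      qed
    qed
    \<comment> \<open>The inclusion in \<open>kernel L\<close> is proper: some \<open>v\<close> in
      \<open>kernel L\<close> has \<open>f v \<noteq> 0\<close>.\<close>
    also have "\<dots> < enat k"
      using sub * assms(4)
      by (intro L.vs1.edim_psubset[of _ "kernel L"] L.vs1.subspace_inter) (auto simp: kernel_def)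
    finally show "X.p.edim ?K < enat k" .
  qed
qed

end
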